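(* Let $\xi$ and $z$ be two commutative free variables (i.e. $n=1$). Then, for any $k\in\mathbb{N}$, all but finitely many of the polynomials $z^{-k}(\xi^m\ast z^{m+k})$ and $\xi^{-k}(\xi^{m+k}\ast z^m)$ $(m\in\mathbb{N})$ are irreducible over $\mathbb{Q}$.
   Context: Here $\partial=\partial/\partial z$, $\delta=\partial/\partial\xi$, and the product $\ast$ on the vector space $\mathbb{C}[\xi,z]$ is $f\ast g:=\mu\big(e^{-\Omega}(f\otimes g)\big)$, where $\Omega=\partial\otimes\delta+\delta\otimes\partial$ and $\mu(f\otimes g)=fg$ is the usual multiplication. Multiplication by $z^{-k}$ and $\xi^{-k}$ is the usual one; the resulting expressions are polynomials in $\xi,z$ with rational coefficients, and irreducibility is in the usual polynomial ring $\mathbb{Q}[\xi,z]$. *)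

theory Defs
  imports "HOL-Computational_Algebra.Computational_Algebra"
begin

text \<open>
  The ring \<open>R[\<xi>,z]\<close> is represented as \<open>R[\<xi>][z]\<close>, i.e. as the type \<open>'a poly poly\<close>
  whose outer variable is \<open>z\<close> and whose inner variable is \<open>\<xi>\<close>.
\<close>

definition zvar :: "'a::comm_semiring_1 poly poly" where
  "zvar = [:0, 1:]"

definition xivar :: "'a::comm_semiring_1 poly poly" where
  "xivar = [:[:0, 1:]:]"

definition d_z :: "'a::idom poly poly \<Rightarrow> 'a poly poly" where
  "d_z = pderiv"

definition d_xi :: "'a::idom poly poly \<Rightarrow> 'a poly poly" where
  "d_xi = map_poly pderiv"

text \<open>
  With \<open>A = \<complex>[\<xi>,z]\<close>, the tensor product \<open>A \<otimes>\<^sub>\<complex> A\<close> is represented as the ring of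
  polynomials in a second copy of \<open>\<xi>\<close> and \<open>z\<close> with coefficients in \<open>A\<close>. Operators on the
  left factor act on the coefficients, operators on the right factor act on the new variables.
\<close>

type_synonym cpoly = "complex poly poly"
type_synonym cpoly_tensor = "cpoly poly poly"

definition tensor :: "cpoly \<Rightarrow> cpoly \<Rightarrow> cpoly_tensor" where
  "tensor f g = map_poly (map_poly (\<lambda>c. smult [:c:] f)) g"

definition on_left :: "(cpoly \<Rightarrow> cpoly) \<Rightarrow> cpoly_tensor \<Rightarrow> cpoly_tensor" where
  "on_left D = map_poly (map_poly D)"

definition Omega :: "cpoly_tensor \<Rightarrow> cpoly_tensor" where
  "Omega t = on_left d_z (d_xi t) + on_left d_xi (d_z t)"

text \<open>
  The multiplication map identifies the second copy of the variables with the first one.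
\<close>

definition mu :: "cpoly_tensor \<Rightarrow> cpoly" where
  "mu t = poly (poly t [:zvar:]) xivar"

text \<open>
  \<open>\<Omega>\<close> is locally nilpotent, so the exponential series has only finitely many nonzero terms
  (see \<open>finite_Omega_support\<close> below).
\<close>

definition exp_neg_Omega :: "cpoly_tensor \<Rightarrow> cpoly_tensor" where
  "exp_neg_Omega t =
     (\<Sum>n | ((\<lambda>s. - Omega s) ^^ n) t \<noteq> 0.
        smult [:[:[:1 / fact n:]:]:] (((\<lambda>s. - Omega s) ^^ n) t))"

definition star :: "cpoly \<Rightarrow> cpoly \<Rightarrow> cpoly" (infixl \<open>\<star>\<close> 70) where
  "f \<star> g = mu (exp_neg_Omega (tensor f g))"

definition irreducible_over_rat :: "cpoly \<Rightarrow> bool" where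
  "irreducible_over_rat p \<longleftrightarrow>
     (\<exists>q :: rat poly poly. p = map_poly (map_poly of_rat) q \<and> irreducible q)"

lemma d_z_0 [simp]: "d_z 0 = 0" and d_xi_0 [simp]: "d_xi 0 = 0"
  by (simp_all add: d_z_def d_xi_def)

lemma d_z_smult: "d_z (smult [:c:] f) = smult [:c:] (d_z f)"
  by (simp add: d_z_def pderiv_smult)

lemma d_xi_smult: "d_xi (smult [:c:] f) = smult [:c:] (d_xi f)"
  by (intro poly_eqI) (simp add: d_xi_def coeff_map_poly coeff_pderiv)

lemma d_z_tensor: "d_z (tensor f g) = tensor f (d_z g)"
  by (intro poly_eqI)
     (simp add: d_z_def tensor_def coeff_map_poly coeff_pderiv of_nat_poly
       flip: of_nat_Suc)

lemma d_xi_tensor: "d_xi (tensor f g) = tensor f (d_xi g)"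
  by (intro poly_eqI)
     (simp add: d_xi_def tensor_def coeff_map_poly coeff_pderiv of_nat_poly
       flip: of_nat_Suc)

lemma on_left_tensor:
  assumes "\<And>c f. D (smult [:c:] f) = smult [:c:] (D f)"
  shows "on_left D (tensor f g) = tensor (D f) g"
proof -
  have "D 0 = 0" using assms[of 0 0] by simp
  then show ?thesis
    by (intro poly_eqI) (simp add: on_left_def tensor_def coeff_map_poly assms)
qed

lemma Omega_tensor:
  "Omega (tensor f g) = tensor (d_z f) (d_xi g) + tensor (d_xi f) (d_z g)"
  by (simp add: Omega_def on_left_tensor d_z_smult d_xi_smult d_z_tensor d_xi_tensor)

lemma mu_tensor: "mu (tensor f g) = f * g"
proof -
  have *: "poly (map_poly (\<lambda>c. smult [:c:] f) p) xivar = f * [:p:]" for p :: "complex poly"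
  proof (induction p)
    case (pCons a p)
    have "[:pCons a p:] = [:[:a:]:] + xivar * [:p:]"
      by (simp add: xivar_def)
    then show ?case using pCons
      by (simp add: map_poly_pCons algebra_simps)
  qed simp
  have "poly (poly (map_poly (map_poly (\<lambda>c. smult [:c:] f)) g) [:zvar:]) xivar = f * g"
  proof (induction g)
    case (pCons a p)
    have "f * pCons a p = smult a f + zvar * (f * p)"
      by (simp add: zvar_def)
    then show ?case using pCons *[of a]
      by (simp add: map_poly_pCons)
  qed simp
  then show ?thesis by (simp add: mu_def tensor_def)
qed

lemma finite_Omega_support: "finite {n. ((\<lambda>s. - Omega s) ^^ n) t \<noteq> 0}"
proof -
  define P where "P d t \<longleftrightarrow> (\<forall>i j. i + j \<ge> d \<longrightarrow> coeff (coeff t i) j = 0)"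
    for d and t :: cpoly_tensor
  have step: "P d (- Omega t)" if "P (Suc d) t" for d t
    using that
    by (auto simp: P_def Omega_def on_left_def d_z_def[where 'a="complex poly poly"]
        d_xi_def[where 'a="complex poly poly"] coeff_map_poly coeff_pderiv of_nat_poly)
  have iter: "P d (((\<lambda>s. - Omega s) ^^ n) t)" if "P (d + n) t" for d n
    using that
  proof (induction n arbitrary: d)
    case (Suc n)
    from Suc.IH[of "Suc d"] Suc.prems show ?case
      by (simp add: step)
  qed simp
  define N where "N = Suc (degree t + (\<Sum>i\<le>degree t. degree (coeff t i)))"
  have PN: "P (d + N) t" for d
    unfolding P_def
  proof (intro allI impI)
    fix i j assume ij: "d + N \<le> i + j"
    show "coeff (coeff t i) j = 0"
    proof (cases "i \<le> degree t")
      case True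
      then have "degree (coeff t i) \<le> (\<Sum>i\<le>degree t. degree (coeff t i))"
        by (intro member_le_sum) auto
      with ij True show ?thesis
        by (intro coeff_eq_0) (simp add: N_def)
    qed (simp add: coeff_eq_0)
  qed
  have "((\<lambda>s. - Omega s) ^^ n) t = 0" if "n \<ge> N" for n
  proof -
    have "P n t" using PN[of "n - N"] that by simp
    then have "P 0 (((\<lambda>s. - Omega s) ^^ n) t)" using iter[of 0 n] by simp
    then show ?thesis by (simp add: P_def poly_eq_iff)
  qed
  then have "{n. ((\<lambda>s. - Omega s) ^^ n) t \<noteq> 0} \<subseteq> {..<N}"
    using not_le_imp_less by blast
  then show ?thesis using finite_subset by blast
qed

lemma fact_choose_Suc: "fact j * (n choose j) * (n - j) = fact (Suc j) * (n choose Suc j)"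
proof -
  have "(n - j) * (n choose j) = Suc j * (n choose Suc j)"
    by (simp only: binomial_absorb_comp binomial_absorption)
  then show ?thesis
    by (metis fact_Suc mult.assoc mult.commute of_nat_id)
qed

lemma d_z_zvar_power: "d_z (zvar ^ r) = smult [:of_nat r:] (zvar ^ (r - 1))"
  by (simp add: d_z_def zvar_def pderiv_power pderiv_pCons of_nat_poly)

lemma d_xi_xivar_power: "d_xi (xivar ^ r) = smult [:of_nat r:] (xivar ^ (r - 1))"
proof -
  have "xivar ^ r = [:[:0, 1::'a:] ^ r:]" for r
    by (induction r) (simp_all add: xivar_def)
  then show ?thesis
    by (simp add: d_xi_def map_poly_pCons pderiv_power pderiv_pCons of_nat_poly)
qed

lemma d_z_xivar_power: "d_z (xivar ^ r) = 0"
  by (simp add: d_z_def xivar_def pderiv_power pderiv_pCons)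

lemma d_xi_zvar_power: "d_xi (zvar ^ r) = 0"
proof (induction r)
  case 0
  show ?case by (simp add: d_xi_def one_pCons map_poly_pCons)
qed (simp add: d_xi_def zvar_def map_poly_pCons)

lemma tensor_minus_left: "tensor (- f) g = - tensor f g"
  by (intro poly_eqI) (simp add: tensor_def coeff_map_poly)

lemma tensor_0 [simp]: "tensor 0 g = 0" "tensor f 0 = 0"
  by (intro poly_eqI, simp add: tensor_def coeff_map_poly)+

lemma Omega_iter_xivar_zvar:
  "((\<lambda>s. - Omega s) ^^ j) (tensor (xivar ^ m) (zvar ^ n)) =
     tensor (smult [:(- 1) ^ j * of_nat (fact j * (m choose j)):] (xivar ^ (m - j)))
            (smult [:of_nat (fact j * (n choose j)):] (zvar ^ (n - j)))"
proof (induction j)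
  case (Suc j)
  have *: "(of_nat (r - j) * of_nat (fact j * (r choose j)) :: complex)
      = of_nat (fact (Suc j) * (r choose Suc j))" for r
    by (metis fact_choose_Suc of_nat_mult mult.commute)
  have **: "(of_nat (r - j) * (c * of_nat (fact j * (r choose j))) :: complex)
      = c * of_nat (fact (Suc j) * (r choose Suc j))" for r c
    by (metis * mult.left_commute)
  show ?case
    unfolding funpow.simps o_apply Suc Omega_tensor d_z_smult d_xi_smult
      d_z_xivar_power d_xi_zvar_power d_z_zvar_power d_xi_xivar_power
      tensor_minus_left[symmetric] smult_smult
    by (simp add: tensor_minus_left[symmetric] * ** smult_minus_left[symmetric]
        del: of_nat_mult fact_Suc smult_minus_left)
qed (simp flip: one_pCons)

lemma star_xivar_zvar:
  "xivar ^ m \<star> zvar ^ n =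
     (\<Sum>j\<le>min m n. smult [:(- 1) ^ j * fact j * of_nat (m choose j) * of_nat (n choose j):]
        (xivar ^ (m - j) * zvar ^ (n - j)))"
proof -
  let ?t = "tensor (xivar ^ m) (zvar ^ n)"
  let ?it = "\<lambda>j. ((\<lambda>s. - Omega s) ^^ j) ?t"
  have mu_sum: "mu (sum h A) = (\<Sum>x\<in>A. mu (h x))" for h :: "nat \<Rightarrow> _" and A
    by (simp add: mu_def poly_sum)
  have mu_smult: "mu (smult [:[:[:c:]:]:] t) = smult [:c:] (mu t)" for c t
    by (simp add: mu_def)
  have "xivar ^ m \<star> zvar ^ n = (\<Sum>j | ?it j \<noteq> 0. smult [:1 / fact j:] (mu (?it j)))"
    by (simp add: star_def exp_neg_Omega_def mu_sum mu_smult)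
  also have "\<dots> = (\<Sum>j\<le>min m n. smult [:1 / fact j:] (mu (?it j)))"
  proof (rule sum.mono_neutral_left)
    show "{j. ?it j \<noteq> 0} \<subseteq> {..min m n}"
      by (auto simp: Omega_iter_xivar_zvar) (metis binomial_eq_0 not_le mult_zero_right of_nat_0 pCons_0_0 smult_0_left tensor_0)+
    show "\<forall>j\<in>{..min m n} - {j. ?it j \<noteq> 0}. smult [:1 / fact j:] (mu (?it j)) = 0"
      by (auto simp: mu_def)
  qed simp
  also have "\<dots> = (\<Sum>j\<le>min m n. smult [:(- 1) ^ j * fact j * of_nat (m choose j) * of_nat (n choose j):]
        (xivar ^ (m - j) * zvar ^ (n - j)))"
    by (rule sum.cong) (simp_all add: Omega_iter_xivar_zvar mu_tensor field_simps)
  finally show ?thesis .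
qed

text \<open>
  Hence multiplying these products by \<open>z\<close> or \<open>\<xi>\<close> to the power \<open>-k\<close> yields polynomials,
  and it coincides with the exact division \<open>div\<close> by the corresponding power.
\<close>

lemma zvar_power_dvd_star: "zvar ^ k dvd xivar ^ m \<star> zvar ^ (m + k)"
  unfolding star_xivar_zvar
  by (intro dvd_sum dvd_smult dvd_mult le_imp_power_dvd) auto

lemma xivar_power_dvd_star: "xivar ^ k dvd xivar ^ (m + k) \<star> zvar ^ m"
  unfolding star_xivar_zvar
  by (intro dvd_sum dvd_smult dvd_mult2 le_imp_power_dvd) auto

end

theory Submission
  imports Defs
begin

text \<open>
  Both products are, after the division, the polynomial \<open>F(\<xi>z)\<close>, where
  \<open>F = \<Sum>\<^sub>j \<plusminus> (m! / j!) \<cdot> (m+k choose k+j) x\<^sup>j\<close> is the monic scalar multiple of the generalized Laguerre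
  polynomial of degree \<open>m\<close> and parameter \<open>k\<close>. Setting \<open>\<xi> = 1\<close> shows that \<open>F(\<xi>z)\<close> is irreducible
  once \<open>F\<close> has no factorization into polynomials of positive degree over the rationals
  (\<open>irreducible_diagonal\<close>), so the theorem is about one variable. There the degree \<open>l\<close> of a
  hypothetical proper factor is caught between two congruences, both read off Newton polygons.

  \<^item> The \<open>p\<close>-adic Newton polygon of the truncated exponential series
    \<open>\<Sum>\<^sub>j\<^sub>\<le>\<^sub>d x\<^sup>j / j!\<close> only has edges of slope \<open>- (1/p + \<dots> + 1/p\<^sup>n)\<close>, and only those with \<open>n \<ge> a\<close>
    if \<open>p\<^sup>a\<close> divides \<open>d\<close> (\<open>truncated_exponential_vertex\<close>). Such a slope has denominator
    \<open>p\<^sup>n\<close>, so every edge of a factor of a polynomial with this polygon has a length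
    divisible by \<open>p\<^sup>a\<close>.
  \<^item> If \<open>p\<^sup>a\<close> divides \<open>m\<close> and \<open>p\<^sup>a > k\<close>, the binomial coefficients in \<open>F\<close> are prime to \<open>p\<close> at the
    vertices of that polygon. Hence \<open>F\<close> has the polygon of the truncated exponential of
    degree \<open>m\<close>, and \<open>p\<^sup>a\<close> divides \<open>l\<close> (\<open>prime_power_dvd_factor_degree\<close>).
  \<^item> If \<open>p\<^sup>a\<close> divides \<open>m - 1\<close> and \<open>p\<^sup>a > k + 1\<close>, then \<open>F\<close> has the polygon of \<open>p\<^sup>e + x\<close> times the
    truncated exponential of degree \<open>m - 1\<close>, where \<open>p\<^sup>e\<close> is the exact power of \<open>p\<close> in \<open>k + 1\<close>.
    The linear factor contributes one edge of length 1, so \<open>l\<close> is 0 or 1 modulo \<open>p\<^sup>a\<close>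
    (\<open>prime_power_dvd_factor_degree_or_pred\<close>).

  The first congruence, over all prime powers exactly dividing \<open>m\<close>, says that \<open>m\<close> divides
  \<open>k! l\<close>, as the prime powers up to \<open>k\<close> divide \<open>k!\<close>; write \<open>k! l = m u\<close>, so that \<open>0 < u < k!\<close>. Modulo a prime power dividing \<open>m - 1\<close> this
  reads \<open>k! l = u\<close>, and the second congruence makes the prime power divide \<open>u\<close> or \<open>k! - u\<close>,
  unless it is at most \<open>k + 1\<close> and divides \<open>(k+1)!\<close>. So
  \<open>m - 1\<close> divides \<open>(k+1)! u (k! - u)\<close>, which is positive and bounded in terms of \<open>k\<close>: this
  leaves finitely many \<open>m\<close>.
\<close>

section \<open>Newton polygons of products\<close>

text \<open>
  The points of the Newton polygon of \<open>f\<close> are the pairs \<open>(i, v\<^sub>p(f\<^sub>i))\<close> with \<open>f\<^sub>i \<noteq> 0\<close>. The height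
  measures them along the direction of slope \<open>- \<sigma>\<close>, so its minimizers, the face, are the points
  on the supporting line of that slope: one vertex, or all points on an edge of slope \<open>- \<sigma>\<close>.
\<close>

definition height :: "int \<Rightarrow> real \<Rightarrow> int poly \<Rightarrow> nat \<Rightarrow> real" where
  "height p \<sigma> f i = real (multiplicity p (coeff f i)) + \<sigma> * real i"

definition face :: "int \<Rightarrow> real \<Rightarrow> int poly \<Rightarrow> nat set" where
  "face p \<sigma> f = {i. coeff f i \<noteq> 0 \<and> (\<forall>j. coeff f j \<noteq> 0 \<longrightarrow> height p \<sigma> f i \<le> height p \<sigma> f j)}"

lemma face_le: "i \<in> face p \<sigma> f \<Longrightarrow> coeff f j \<noteq> 0 \<Longrightarrow> height p \<sigma> f i \<le> height p \<sigma> f j"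
  and face_coeff: "i \<in> face p \<sigma> f \<Longrightarrow> coeff f i \<noteq> 0"
  by (auto simp: face_def)

lemma finite_face: "finite (face p \<sigma> f)"
  by (rule finite_subset[of _ "{..degree f}"]) (auto simp: face_def le_degree)

lemma face_nonempty:
  assumes "f \<noteq> 0" shows "face p \<sigma> f \<noteq> {}"
proof -
  let ?S = "{i. coeff f i \<noteq> 0}"
  have "finite ?S" by (rule finite_subset[of _ "{..degree f}"]) (auto simp: le_degree)
  moreover have "?S \<noteq> {}" using assms by (auto simp: poly_eq_iff)
  ultimately have "arg_min_on (height p \<sigma> f) ?S \<in> face p \<sigma> f"
    using arg_min_if_finite(1)[of ?S "height p \<sigma> f"] arg_min_least[of ?S _ "height p \<sigma> f"]
    by (simp add: face_def)
  then show ?thesis by blast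
qed

text \<open>
  The polygon is convex: faces move to the left as \<open>\<sigma>\<close> grows.
\<close>

lemma face_antimono:
  assumes "\<sigma> < \<tau>" "i \<in> face p \<sigma> f" "j \<in> face p \<tau> f"
  shows "j \<le> i"
proof -
  have "height p \<sigma> f i \<le> height p \<sigma> f j" "height p \<tau> f j \<le> height p \<tau> f i"
    using assms by (auto simp: face_def)
  then have "(\<tau> - \<sigma>) * real j \<le> (\<tau> - \<sigma>) * real i"
    by (simp add: height_def algebra_simps)
  with assms(1) show ?thesis by simp
qed

text \<open>
  If \<open>(i, j)\<close> is the only pair of face points with sum \<open>i + j\<close>, then in the convolution sum for
  the coefficient of \<open>g * h\<close> at \<open>i + j\<close> a single term has the least valuation, so nothing cancels.
  The hypothesis holds for the two left ends and for the two right ends of the faces.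
\<close>

lemma face_mult:
  assumes p: "prime p" and i: "i \<in> face p \<sigma> g" and j: "j \<in> face p \<sigma> h"
    and uniq: "\<And>i' j'. i' \<in> face p \<sigma> g \<Longrightarrow> j' \<in> face p \<sigma> h \<Longrightarrow> i' + j' = i + j \<Longrightarrow> i' = i"
  shows "i + j \<in> face p \<sigma> (g * h)"
proof -
  define c where "c = height p \<sigma> g i + height p \<sigma> h j"
  have pe: "prime_elem p" and nu: "\<not> is_unit p" using p by auto
  have val: "real (multiplicity p (coeff g a * coeff h b)) + \<sigma> * real (a + b)
      = height p \<sigma> g a + height p \<sigma> h b" if "coeff g a \<noteq> 0" "coeff h b \<noteq> 0" for a b
    using that pe by (simp add: height_def prime_elem_multiplicity_mult_distrib algebra_simps)
  have lower: "c \<le> height p \<sigma> (g * h) n" if n: "coeff (g * h) n \<noteq> 0" for n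
  proof -
    define t where "t = Suc (multiplicity p (coeff (g * h) n))"
    have "\<not> p ^ t dvd coeff (g * h) n"
      using n nu by (simp add: t_def power_dvd_iff_le_multiplicity del: power_Suc)
    then obtain a where a: "a \<le> n" "\<not> p ^ t dvd coeff g a * coeff h (n - a)"
      unfolding coeff_mult by (meson dvd_sum atMost_iff)
    then have nz: "coeff g a \<noteq> 0" "coeff h (n - a) \<noteq> 0" by auto
    have "multiplicity p (coeff g a * coeff h (n - a)) < t"
      using a(2) multiplicity_dvd' not_le by blast
    moreover have "c \<le> height p \<sigma> g a + height p \<sigma> h (n - a)"
      unfolding c_def by (intro add_mono face_le[OF i nz(1)] face_le[OF j nz(2)])
    ultimately show ?thesis
      using val[OF nz] a(1) by (simp add: height_def t_def)
  qed
  let ?n = "i + j"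
  define r where "r = multiplicity p (coeff g i * coeff h j)"
  have nz: "coeff g i \<noteq> 0" "coeff h j \<noteq> 0" using i j by (auto simp: face_coeff)
  have r: "real r + \<sigma> * real ?n = c"
    using val[OF nz] by (simp add: r_def c_def)
  have other: "p ^ Suc r dvd coeff g a * coeff h (?n - a)" if a: "a \<in> {..?n} - {i}" for a
  proof (cases "coeff g a = 0 \<or> coeff h (?n - a) = 0")
    case False
    then have nz': "coeff g a \<noteq> 0" "coeff h (?n - a) \<noteq> 0" by auto
    have "\<not> (a \<in> face p \<sigma> g \<and> ?n - a \<in> face p \<sigma> h)"
      using uniq[of a "?n - a"] a by auto
    then have "c < height p \<sigma> g a + height p \<sigma> h (?n - a)"
    proof (rule contrapos_np)
      assume *: "\<not> c < height p \<sigma> g a + height p \<sigma> h (?n - a)"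
      have 1: "height p \<sigma> g i \<le> height p \<sigma> g a" "height p \<sigma> h j \<le> height p \<sigma> h (?n - a)"
        using face_le[OF i nz'(1)] face_le[OF j nz'(2)] by auto
      then have "height p \<sigma> g a = height p \<sigma> g i" "height p \<sigma> h (?n - a) = height p \<sigma> h j"
        using * by (auto simp: c_def)
      then show "a \<in> face p \<sigma> g \<and> ?n - a \<in> face p \<sigma> h"
        using i j nz' by (auto simp: face_def)
    qed
    also have "\<dots> = real (multiplicity p (coeff g a * coeff h (?n - a))) + \<sigma> * real ?n"
      using val[OF nz'] a by simp
    finally have "r < multiplicity p (coeff g a * coeff h (?n - a))"
      using r by simp
    then show ?thesis by (intro multiplicity_dvd') simp
  qed auto
  have "coeff (g * h) ?n = coeff g i * coeff h j
      + (\<Sum>a\<in>{..?n} - {i}. coeff g a * coeff h (?n - a))"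
    unfolding coeff_mult by (subst sum.remove[of _ i]) auto
  moreover have "p ^ Suc r dvd (\<Sum>a\<in>{..?n} - {i}. coeff g a * coeff h (?n - a))"
    by (intro dvd_sum other)
  moreover have "\<not> p ^ Suc r dvd coeff g i * coeff h j"
    using nz nu by (simp add: r_def power_dvd_iff_le_multiplicity del: power_Suc)
  ultimately have nd: "\<not> p ^ Suc r dvd coeff (g * h) ?n"
    by (simp add: dvd_add_left_iff del: power_Suc)
  then have "coeff (g * h) ?n \<noteq> 0" "multiplicity p (coeff (g * h) ?n) \<le> r"
    using multiplicity_dvd'[of "Suc r" p] by (auto simp: not_less_eq_eq[symmetric] simp del: power_Suc)
  moreover from this have "height p \<sigma> (g * h) ?n \<le> c"
    using r by (simp add: height_def)
  ultimately show ?thesis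
    using lower by (force simp: face_def)
qed

text \<open>
  The left ends of the faces of the factors add up to a face point of the product, and so do the
  right ends. So an edge of a factor is no longer than the edge of the same slope of the product.
\<close>

lemma face_mult_width:
  assumes p: "prime p" and gh: "g * h \<noteq> 0"
    and ij: "i \<in> face p \<sigma> g" "j \<in> face p \<sigma> g"
  obtains i' j' where "i' \<in> face p \<sigma> (g * h)" "j' \<in> face p \<sigma> (g * h)"
    "int j - int i \<le> int j' - int i'"
proof -
  let ?G = "face p \<sigma> g" and ?H = "face p \<sigma> h"
  have fin: "finite ?G" "finite ?H" by (rule finite_face)+
  have ne: "?G \<noteq> {}" "?H \<noteq> {}" using gh by (auto simp: face_nonempty)
  have "Min ?G + Min ?H \<in> face p \<sigma> (g * h)"
  proof (rule face_mult[OF p])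
    fix i' j' assume a: "i' \<in> ?G" "j' \<in> ?H" "i' + j' = Min ?G + Min ?H"
    have "Min ?G \<le> i'" "Min ?H \<le> j'" using a fin by auto
    then show "i' = Min ?G" using a(3) by linarith
  qed (use fin ne in auto)
  moreover have "Max ?G + Max ?H \<in> face p \<sigma> (g * h)"
  proof (rule face_mult[OF p])
    fix i' j' assume a: "i' \<in> ?G" "j' \<in> ?H" "i' + j' = Max ?G + Max ?H"
    have "i' \<le> Max ?G" "j' \<le> Max ?H" using a fin by auto
    then show "i' = Max ?G" using a(3) by linarith
  qed (use fin ne in auto)
  moreover have "Min ?G \<le> i" "j \<le> Max ?G" using ij fin by auto
  moreover have "Min ?H \<le> Max ?H" using ne fin by (meson Max_ge Min_in)
  ultimately show ?thesis by (intro that[of "Min ?G + Min ?H" "Max ?G + Max ?H"]) auto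
qed

text \<open>
  The degree is the sum of the lengths of the edges. If all lengths are divisible by \<open>q\<close>, except
  for at most one edge, of slope \<open>- \<rho>\<close> and length at most \<open>w\<close>, then the degree is congruent
  modulo \<open>q\<close> to the length of the exceptional edge.
\<close>

lemma degree_from_edges:
  fixes q w :: nat
  assumes g0: "coeff g 0 \<noteq> 0"
    and edge: "\<And>\<sigma> i j. \<sigma> \<noteq> \<rho> \<Longrightarrow> i \<in> face p \<sigma> g \<Longrightarrow> j \<in> face p \<sigma> g \<Longrightarrow> int q dvd int j - int i"
    and exc: "\<And>i j. i \<in> face p \<rho> g \<Longrightarrow> j \<in> face p \<rho> g \<Longrightarrow> int j - int i \<le> int w"
  shows "\<exists>t\<le>w. int q dvd int (degree g) - int t"
proof -
  have g: "g \<noteq> 0" using g0 by auto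
  define F0 where "F0 = face p \<rho> g"
  have F0: "finite F0" "F0 \<noteq> {}" using finite_face face_nonempty[OF g] by (auto simp: F0_def)
  define D where "D = Max F0 - Min F0"
  have MM: "Min F0 \<le> Max F0" using F0 by (meson Max_ge Min_in)
  have "int (Max F0) - int (Min F0) \<le> int w"
    using exc Min_in[OF F0] Max_in[OF F0] by (simp add: F0_def)
  then have Dw: "D \<le> w" by (simp add: D_def)
  \<comment> \<open>The sum over the edges is an induction over the vertices \<open>j\<close>: each vertex other than 0 is the
      right end of an edge, whose left end \<open>L\<close> is covered by the induction hypothesis. The residue
      changes from 0 to \<open>D\<close> when the exceptional slope is passed.\<close>
  have walk: "(\<rho> \<le> \<sigma> \<longrightarrow> int q dvd int j) \<and> (\<sigma> < \<rho> \<longrightarrow> int q dvd int j - int D)"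
    if "j \<in> face p \<sigma> g" "\<And>i. i \<in> face p \<sigma> g \<Longrightarrow> j \<le> i" for j \<sigma>
    using that
  proof (induction j arbitrary: \<sigma> rule: less_induct)
    case (less j)
    show ?case
    proof (cases "j = 0")
      case True
      have "D = 0" if "\<sigma> < \<rho>"
        using face_antimono[OF that less.prems(1), of "Max F0"] Max_in[OF F0] True
        by (simp add: D_def F0_def)
      then show ?thesis using True by simp
    next
      case False
      define S where "S = {i. i < j \<and> coeff g i \<noteq> 0}"
      \<comment> \<open>The edge that ends in \<open>j\<close> is the segment of largest slope from an earlier point to \<open>j\<close>.\<close>
      define sl where "sl i = (real (multiplicity p (coeff g i)) - real (multiplicity p (coeff g j)))
          / (real j - real i)" for i
      have S: "finite S" "S \<noteq> {}" using False g0 by (auto simp: S_def)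
      obtain a where a: "a \<in> S" "\<forall>i\<in>S. sl a \<le> sl i"
        using arg_min_if_finite(1)[of S sl] arg_min_least[of S _ sl] S by blast
      define \<tau> where "\<tau> = sl a"
      have slope: "height p \<tau> g j \<le> height p \<tau> g i \<longleftrightarrow> \<tau> \<le> sl i"
        "height p \<tau> g i = height p \<tau> g j \<longleftrightarrow> \<tau> = sl i" if "i < j" for i \<tau>
        using that by (auto simp: height_def sl_def field_simps)
      have gt: "\<sigma> < \<tau>"
      proof -
        have aj: "a < j" "coeff g a \<noteq> 0" using a(1) by (auto simp: S_def)
        have "height p \<sigma> g j \<noteq> height p \<sigma> g a"
        proof
          assume "height p \<sigma> g j = height p \<sigma> g a"
          then have "a \<in> face p \<sigma> g" using less.prems(1) aj(2) by (auto simp: face_def)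
          then show False using less.prems(2)[of a] aj(1) by simp
        qed
        moreover have "height p \<sigma> g j \<le> height p \<sigma> g a"
          using face_le[OF less.prems(1) aj(2)] .
        ultimately show ?thesis using slope[OF aj(1), of \<sigma>] by (auto simp: \<tau>_def)
      qed
      have jk: "j \<in> face p \<tau> g"
      proof -
        have "height p \<tau> g j \<le> height p \<tau> g i" if i: "coeff g i \<noteq> 0" for i
        proof (cases "i < j")
          case True
          then show ?thesis using slope(1)[OF True] a(2) i by (simp add: \<tau>_def S_def)
        next
          case False
          have "height p \<sigma> g j \<le> height p \<sigma> g i"
            using face_le[OF less.prems(1) i] .
          moreover have "(\<tau> - \<sigma>) * real j \<le> (\<tau> - \<sigma>) * real i"
            using gt False by (intro mult_left_mono) auto
          ultimately show ?thesis by (simp add: height_def algebra_simps)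
        qed
        then show ?thesis using face_coeff[OF less.prems(1)] by (auto simp: face_def)
      qed
      define L where "L = Min (face p \<tau> g)"
      have L: "L \<in> face p \<tau> g" "\<And>i. i \<in> face p \<tau> g \<Longrightarrow> L \<le> i"
        using finite_face[of p \<tau> g] face_nonempty[OF g, of p \<tau>] by (auto simp: L_def)
      have "a \<in> face p \<tau> g"
        using a(1) jk slope(2)[of a \<tau>] by (auto simp: face_def S_def \<tau>_def)
      then have "L < j" using L(2)[of a] a(1) by (auto simp: S_def)
      note IH = less.IH[OF this L]
      have top: "i \<le> j" if "i \<in> face p \<tau> g" for i
        using face_antimono[OF gt less.prems(1) that] .
      show ?thesis
      proof (cases "\<tau> = \<rho>")
        case True
        have "L = Min F0" by (simp add: L_def F0_def True)
        moreover have "j = Max F0"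
          using top jk F0 by (intro antisym) (auto simp: F0_def True)
        ultimately have "int j - int D = int L" using MM by (simp add: D_def)
        then show ?thesis using IH gt True by auto
      next
        case neq: False
        have jL: "int q dvd int j - int L" using edge[OF neq L(1) jk] .
        have *: "D = 0" if "\<sigma> < \<rho>" "\<rho> < \<tau>"
        proof -
          have "Max F0 \<le> j" "j \<le> Min F0"
            using face_antimono[OF that(1) less.prems(1)] face_antimono[OF that(2) _ jk]
              Min_in[OF F0] Max_in[OF F0] by (auto simp: F0_def)
          then show ?thesis by (simp add: D_def)
        qed
        have j: "int j = (int j - int L) + int L" "int j - int D = (int j - int L) + (int L - int D)"
          by auto
        show ?thesis
        proof (intro conjI impI)
          assume "\<rho> \<le> \<sigma>"
          then have "int q dvd int L" using IH gt by auto
          then show "int q dvd int j" using dvd_add[OF jL] by (subst j(1))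
        next
          assume l: "\<sigma> < \<rho>"
          have "int q dvd int L - int D"
            using IH neq * l by (cases "\<rho> < \<tau>") auto
          then show "int q dvd int j - int D" using dvd_add[OF jL] by (subst j(2))
        qed
      qed
    qed
  qed
  \<comment> \<open>For \<open>\<sigma>\<close> this negative the only minimizer is the last point of the polygon.\<close>
  define \<sigma> where "\<sigma> = min \<rho> 0 - 1 - real (multiplicity p (coeff g (degree g)))"
  have strict: "height p \<sigma> g (degree g) < height p \<sigma> g i" if "i < degree g" for i
  proof -
    have "\<sigma> * (real (degree g) - real i) \<le> \<sigma> * 1"
      using that by (intro mult_left_mono_neg) (auto simp: \<sigma>_def)
    also have "\<dots> < real (multiplicity p (coeff g i)) - real (multiplicity p (coeff g (degree g)))"
      by (simp add: \<sigma>_def)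
    finally show ?thesis by (simp add: height_def algebra_simps)
  qed
  have nz: "coeff g (degree g) \<noteq> 0" using g by simp
  have "height p \<sigma> g (degree g) \<le> height p \<sigma> g i" if "coeff g i \<noteq> 0" for i
    using le_degree[OF that] strict[of i] by (cases "i = degree g") auto
  then have top: "degree g \<in> face p \<sigma> g" using nz by (auto simp: face_def)
  have "degree g \<le> i" if "i \<in> face p \<sigma> g" for i
    using face_le[OF that nz] strict[of i] by (cases "i < degree g") auto
  then have "int q dvd int (degree g) - int D"
    using walk[OF top] by (auto simp: \<sigma>_def)
  then show ?thesis using Dw by blast
qed

text \<open>
  Over a segment of slope \<open>- \<sigma>\<close> and horizontal length \<open>d\<close> the integer valuations change by
  \<open>\<sigma> d\<close>. So if \<open>\<sigma>\<close> has a denominator divisible by \<open>q\<close>, then \<open>q\<close> divides the length of every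
  edge of that slope, in any polynomial. Hence only the slopes of the product matter for its factors.
\<close>

lemma degree_factor_from_slopes:
  fixes q w :: nat
  assumes p: "prime p" and gh0: "coeff (g * h) 0 \<noteq> 0"
    and slope: "\<And>\<sigma> i j. \<sigma> \<noteq> \<rho> \<Longrightarrow> i \<in> face p \<sigma> (g * h) \<Longrightarrow> j \<in> face p \<sigma> (g * h) \<Longrightarrow> i \<noteq> j
        \<Longrightarrow> (\<And>d z :: int. \<sigma> * of_int d = of_int z \<Longrightarrow> int q dvd d)"
    and exc: "\<And>i j. i \<in> face p \<rho> (g * h) \<Longrightarrow> j \<in> face p \<rho> (g * h) \<Longrightarrow> int j - int i \<le> int w"
  shows "\<exists>t\<le>w. int q dvd int (degree g) - int t"
proof (rule degree_from_edges)
  have gh: "g * h \<noteq> 0" using gh0 by force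
  show "coeff g 0 \<noteq> 0" using gh0 by (simp add: coeff_mult)
  show "int j - int i \<le> int w" if ij: "i \<in> face p \<rho> g" "j \<in> face p \<rho> g" for i j
  proof -
    obtain i' j' where "i' \<in> face p \<rho> (g * h)" "j' \<in> face p \<rho> (g * h)"
      "int j - int i \<le> int j' - int i'"
      by (rule face_mult_width[OF p gh ij])
    then show ?thesis using exc[of i' j'] by linarith
  qed
  show "int q dvd int j - int i" if neq: "\<sigma> \<noteq> \<rho>" and ij: "i \<in> face p \<sigma> g" "j \<in> face p \<sigma> g" for \<sigma> i j
  proof (cases "i = j")
    case False
    have lt: "\<exists>i' j'. i' \<in> face p \<sigma> (g * h) \<and> j' \<in> face p \<sigma> (g * h) \<and> i' \<noteq> j'"
      if ab: "a < b" "a \<in> face p \<sigma> g" "b \<in> face p \<sigma> g" for a b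
    proof -
      obtain i' j' where *: "i' \<in> face p \<sigma> (g * h)" "j' \<in> face p \<sigma> (g * h)"
        "int b - int a \<le> int j' - int i'"
        by (rule face_mult_width[OF p gh ab(2,3)])
      then have "i' \<noteq> j'" using ab(1) by auto
      with * show ?thesis by blast
    qed
    obtain i' j' where *: "i' \<in> face p \<sigma> (g * h)" "j' \<in> face p \<sigma> (g * h)" "i' \<noteq> j'"
      using lt[of i j] lt[of j i] ij False by (meson linorder_neqE_nat)
    have "height p \<sigma> g i = height p \<sigma> g j"
      using ij by (intro antisym) (auto simp: face_def)
    then have "\<sigma> * of_int (int j - int i)
        = of_int (int (multiplicity p (coeff g i)) - int (multiplicity p (coeff g j)))"
      by (simp add: height_def algebra_simps)
    then show ?thesis using slope[OF neq *] by blast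
  qed simp
qed

section \<open>The Newton polygon of the truncated exponential series\<close>

text \<open>
  Legendre's formula. The free upper bound allows sums for different factorials to be compared
  term by term.
\<close>

lemma multiplicity_fact:
  fixes p :: nat
  assumes p: "prime p" and "n \<le> M"
  shows "multiplicity p (fact n :: nat) = (\<Sum>i=1..M. n div p ^ i)"
  using assms(2)
proof (induction n)
  case (Suc n)
  have p1: "1 < p" using p by (rule prime_gt_1_nat)
  let ?v = "multiplicity p (Suc n)"
  have "?v < p ^ ?v" using p1 by (simp add: power_gt_expt)
  also have "\<dots> \<le> Suc n" by (intro dvd_imp_le multiplicity_dvd) simp
  finally have vM: "?v \<le> M" using Suc.prems by simp
  have "{i \<in> {1..M}. p ^ i dvd Suc n} = {1..?v}"
    using vM p1 by (auto simp: power_dvd_iff_le_multiplicity)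
  then have ind: "(\<Sum>i=1..M. if p ^ i dvd Suc n then 1 else 0) = ?v"
    by (simp add: sum.If_cases Int_def conj_commute)
  have "Suc n div p ^ i = n div p ^ i + (if p ^ i dvd Suc n then 1 else 0)" for i
    by (auto simp: div_Suc dvd_eq_mod_eq_0)
  then have "(\<Sum>i=1..M. Suc n div p ^ i) = (\<Sum>i=1..M. n div p ^ i) + ?v"
    by (simp only: sum.distrib ind)
  also have "\<dots> = multiplicity p (fact (Suc n) :: nat)"
  proof -
    have "multiplicity p (fact (Suc n) :: nat) = multiplicity p (Suc n * fact n)"
      by (simp only: fact_Suc of_nat_id)
    also have "\<dots> = ?v + multiplicity p (fact n :: nat)"
      using p by (intro prime_elem_multiplicity_mult_distrib) auto
    finally show ?thesis using Suc by simp
  qed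
  finally show ?case by simp
qed simp

text \<open>
  The slopes of the Newton polygon of the exponential series, up to sign.
\<close>

definition edge_slope :: "nat \<Rightarrow> nat \<Rightarrow> real" where
  "edge_slope p n = (\<Sum>i=1..n. 1 / real p ^ i)"

text \<open>
  In Legendre's formula the terms with \<open>i \<le> n\<close> lose nothing to rounding at a multiple \<open>V\<close> of
  \<open>p\<^sup>n\<close>, and rounding only decreases them at \<open>j\<close>.
\<close>

lemma multiplicity_fact_diff_ge:
  assumes p: "prime p" and V: "p ^ n dvd V" and j: "j \<le> V"
  shows "edge_slope p n * (real V - real j)
    \<le> real (multiplicity p (fact V :: nat)) - real (multiplicity p (fact j :: nat))"
proof -
  define M where "M = n + V"
  have "edge_slope p n * (real V - real j) = (\<Sum>i=1..n. (real V - real j) / real p ^ i)"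
    by (simp add: edge_slope_def sum_distrib_right)
  also have "\<dots> \<le> (\<Sum>i=1..n. real (V div p ^ i) - real (j div p ^ i))"
  proof (rule sum_mono)
    fix i assume "i \<in> {1..n}"
    then have "p ^ i dvd V" using V by (meson atLeastAtMost_iff dvd_trans le_imp_power_dvd)
    then have "real (V div p ^ i) = real V / real p ^ i" by (simp add: real_of_nat_div)
    moreover have "real (j div p ^ i) \<le> real j / real p ^ i"
      using of_nat_div_le_of_nat[of j "p ^ i", where 'a=real] by simp
    ultimately show "(real V - real j) / real p ^ i \<le> real (V div p ^ i) - real (j div p ^ i)"
      by (simp add: diff_divide_distrib)
  qed
  also have "\<dots> \<le> (\<Sum>i=1..M. real (V div p ^ i) - real (j div p ^ i))"
    using j by (intro sum_mono2) (auto simp: M_def div_le_mono)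
  also have "\<dots> = real (multiplicity p (fact V :: nat)) - real (multiplicity p (fact j :: nat))"
    using p j by (simp add: multiplicity_fact[of p _ M] M_def sum_subtractf)
  finally show ?thesis .
qed

text \<open>
  In base \<open>p\<close> the addition \<open>V + R\<close> has no carry.
\<close>

lemma multiplicity_fact_add:
  assumes p: "prime p" and V: "p ^ n dvd V" and R: "R < p ^ n"
  shows "multiplicity p (fact (V + R) :: nat) = multiplicity p (fact V :: nat) + multiplicity p (fact R :: nat)"
proof -
  define M where "M = V + R"
  have "(V + R) div p ^ i = V div p ^ i + R div p ^ i" for i
  proof (cases "i \<le> n")
    case True
    then have "p ^ i dvd V" using V by (meson dvd_trans le_imp_power_dvd)
    then show ?thesis by (simp add: div_plus_div_distrib_dvd_left)
  next
    case False
    then have i: "p ^ i = p ^ n * p ^ (i - n)" by (simp flip: power_add)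
    have "(V + R) div p ^ n = V div p ^ n"
      using V R by (simp add: div_plus_div_distrib_dvd_left)
    moreover have "R div p ^ n = 0" using R by simp
    ultimately show ?thesis unfolding i div_mult2_eq by simp
  qed
  then show ?thesis
    using p by (simp add: multiplicity_fact[of p _ M] M_def sum.distrib)
qed

lemma multiplicity_fact_le:
  assumes p: "prime p" and R: "R < p ^ Suc n"
  shows "real (multiplicity p (fact R :: nat)) \<le> edge_slope p n * real R"
proof -
  define M where "M = n + R"
  have "real (multiplicity p (fact R :: nat)) = (\<Sum>i=1..M. real (R div p ^ i))"
    using p by (simp add: multiplicity_fact[of p _ M] M_def)
  also have "\<dots> = (\<Sum>i=1..n. real (R div p ^ i))"
  proof (rule sum.mono_neutral_right)
    show "\<forall>i\<in>{1..M} - {1..n}. real (R div p ^ i) = 0"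
    proof
      fix i assume "i \<in> {1..M} - {1..n}"
      then have "p ^ Suc n \<le> p ^ i"
        using p by (intro power_increasing) (auto simp: Suc_le_eq prime_gt_0_nat)
      then show "real (R div p ^ i) = 0" using R by simp
    qed
  qed (auto simp: M_def)
  also have "\<dots> \<le> (\<Sum>i=1..n. real R / real p ^ i)"
    using of_nat_div_le_of_nat[of R, where 'a=real] by (intro sum_mono) (metis of_nat_power)
  also have "\<dots> = edge_slope p n * real R"
    by (simp add: edge_slope_def sum_distrib_right)
  finally show ?thesis .
qed

lemma edge_slope_bounds:
  assumes "prime p" "0 < n"
  shows "0 < edge_slope p n" "edge_slope p n < 1"
proof -
  have p2: "2 \<le> real p" using prime_ge_2_nat[OF assms(1)] by simp
  then show "0 < edge_slope p n"
    unfolding edge_slope_def using assms(2) by (intro sum_pos) auto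
  have "edge_slope p n \<le> 1 - 1 / 2 ^ n" for n
  proof (induction n)
    case (Suc n)
    have "1 / real p ^ Suc n \<le> 1 / 2 ^ Suc n"
      using p2 by (intro divide_left_mono power_mono) auto
    with Suc show ?case by (simp add: edge_slope_def)
  qed (simp add: edge_slope_def)
  from this[of n] show "edge_slope p n < 1" by (smt (verit) divide_pos_pos zero_less_power)
qed

text \<open>
  The sum \<open>1/p + \<dots> + 1/p\<^sup>n\<close> has exact denominator \<open>p\<^sup>n\<close>, since its numerator
  \<open>1 + p + \<dots>\<close> is prime to \<open>p\<close>.
\<close>

lemma edge_slope_denominator:
  assumes p: "prime p" and eq: "edge_slope p n * of_int d = of_int z"
  shows "int p ^ n dvd d"
proof -
  have p0: "real p \<noteq> 0" using p by auto
  have "\<exists>N. edge_slope p n * real p ^ n = of_int N \<and> coprime N (int p ^ n)"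
  proof (induction n)
    case 0
    then show ?case by (intro exI[of _ 0]) (simp add: edge_slope_def)
  next
    case (Suc n)
    then obtain N where N: "edge_slope p n * real p ^ n = of_int N" by blast
    have "edge_slope p (Suc n) * real p ^ Suc n = of_int (int p * N + 1)"
      using N p0 by (simp add: edge_slope_def field_simps)
    moreover have "coprime (int p * N + 1) (int p)"
      by (metis coprime_add_one_left coprime_commute coprime_mult_left_iff add.commute)
    ultimately show ?case by (metis coprime_power_right_iff)
  qed
  then obtain N where N: "edge_slope p n * real p ^ n = of_int N" "coprime N (int p ^ n)" by blast
  have "of_int (N * d) = edge_slope p n * of_int d * real p ^ n"
    by (simp flip: N(1))
  also have "\<dots> = of_int (int p ^ n * z)" by (simp add: eq)
  finally have "N * d = int p ^ n * z" by (simp only: of_int_eq_iff)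
  then have "int p ^ n dvd N * d" by simp
  then show ?thesis using N(2) by (simp add: coprime_commute coprime_dvd_mult_right_iff)
qed

text \<open>
  The points \<open>(j, - v\<^sub>p(j!))\<close> with \<open>j \<le> d\<close> have a unique minimal height for every \<open>\<sigma>\<close> that is not
  an edge slope with \<open>n \<ge> a\<close>. The minimum is at \<open>d\<close> with its last \<open>n\<close> base \<open>p\<close> digits cleared, where \<open>n\<close> is
  the place of \<open>\<sigma>\<close> in the increasing sequence of edge slopes. As the last \<open>a\<close> digits of \<open>d\<close> are
  zero, the edge slopes with \<open>n < a\<close> do not occur.
\<close>

lemma truncated_exponential_vertex:
  assumes p: "prime p" and q: "p ^ a dvd d"
    and ne: "\<And>n. a \<le> n \<Longrightarrow> \<sigma> \<noteq> edge_slope p n"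
  obtains n where "a \<le> n"
    "\<And>j. j \<le> d \<Longrightarrow> j \<noteq> d - d mod p ^ n \<Longrightarrow>
       real (multiplicity p (fact j :: nat)) - \<sigma> * real j
       < real (multiplicity p (fact (d - d mod p ^ n) :: nat)) - \<sigma> * real (d - d mod p ^ n)"
proof -
  have p1: "1 < p" using p by (rule prime_gt_1_nat)
  \<comment> \<open>The least \<open>n\<close> with \<open>P n\<close> locates \<open>\<sigma>\<close> between two consecutive edge slopes; the second
      alternative covers \<open>\<sigma>\<close> above all slopes that fit into degree \<open>d\<close>, where the vertex is 0.\<close>
  define P where "P n \<longleftrightarrow> a \<le> n \<and> (\<sigma> < edge_slope p n \<or> d < p ^ n)" for n
  have "d < p ^ d" using p1 by (simp add: power_gt_expt)
  also have "\<dots> \<le> p ^ (a + d)" using p1 by (intro power_increasing) auto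
  finally have "P (a + d)" by (simp add: P_def)
  then obtain n where n: "P n" "\<And>i. i < n \<Longrightarrow> \<not> P i"
    by (metis LeastI not_less_Least)
  define V where "V = d - d mod p ^ n"
  have V: "p ^ n dvd V" "V \<le> d" "d < V + p ^ n"
  proof -
    have "d mod p ^ n < p ^ n" "d mod p ^ n \<le> d" using p1 by auto
    then show "d < V + p ^ n" "V \<le> d" unfolding V_def by linarith+
  qed (simp add: V_def dvd_minus_mod)
  have an: "a \<le> n" using n(1) by (simp add: P_def)
  show ?thesis
  proof (rule that[OF an], fold V_def)
    fix j assume j: "j \<le> d" "j \<noteq> V"
    show "real (multiplicity p (fact j :: nat)) - \<sigma> * real j
        < real (multiplicity p (fact V :: nat)) - \<sigma> * real V"
    proof (cases "j < V")
      case True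
      then have "\<sigma> < edge_slope p n"
        using n(1) V(2) dvd_imp_le[OF V(1)] by (auto simp: P_def)
      then have "\<sigma> * (real V - real j) < edge_slope p n * (real V - real j)"
        using True by (intro mult_strict_right_mono) auto
      with multiplicity_fact_diff_ge[OF p V(1), of j] True show ?thesis
        by (simp add: algebra_simps)
    next
      case False
      with j have Vj: "V < j" by simp
      have "n \<noteq> a" using q Vj j(1) by (auto simp: V_def)
      then obtain n' where n': "n = Suc n'" "a \<le> n'" using an by (cases n) auto
      have "edge_slope p n' < \<sigma>"
        using n(2)[of n'] ne[of n'] n' by (auto simp: P_def)
      then have "edge_slope p n' * (real j - real V) < \<sigma> * (real j - real V)"
        using Vj by (intro mult_strict_right_mono) auto
      moreover have "real (multiplicity p (fact (j - V) :: nat)) \<le> edge_slope p n' * real (j - V)"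
        using V(3) j(1) Vj n'(1) by (intro multiplicity_fact_le[OF p]) auto
      moreover have "multiplicity p (fact j :: nat)
          = multiplicity p (fact V :: nat) + multiplicity p (fact (j - V) :: nat)"
        using multiplicity_fact_add[OF p V(1), of "j - V"] V(3) j(1) Vj by simp
      ultimately show ?thesis using Vj by (simp add: of_nat_diff algebra_simps)
    qed
  qed
qed

text \<open>
  Clearing the last \<open>n\<close> digits of \<open>m\<close> gives \<open>V\<close>, and \<open>m + k\<close> is the sum of \<open>k + V\<close> and the cleared
  part. This addition in base \<open>p\<close> has no carry: \<open>k\<close> occupies only the last \<open>a\<close> places, where
  both \<open>V\<close> and the cleared part have zeros.
\<close>

lemma binomial_not_dvd:
  assumes p: "prime p" and q: "p ^ a dvd m" "k < p ^ a" "a \<le> n"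
  shows "\<not> p dvd ((m + k) choose (k + (m - m mod p ^ n)))"
proof -
  have p1: "1 < p" using p by (rule prime_gt_1_nat)
  define r where "r = m mod p ^ n"
  define V where "V = m - r"
  have V: "p ^ n dvd V" "m = V + r" by (auto simp: V_def r_def dvd_minus_mod)
  have pd: "p ^ a dvd p ^ n" using q(3) by (rule le_imp_power_dvd)
  have r: "p ^ a dvd r" unfolding r_def using q(1) pd by (simp add: dvd_mod)
  have rk: "r + k < p ^ n"
  proof -
    obtain s where s: "r = p ^ a * s" using r by blast
    obtain t where t: "p ^ n = p ^ a * t" using pd by blast
    have "r < p ^ n" using p1 by (simp add: r_def)
    then have "s < t" using s t by simp
    then have "p ^ a * Suc s \<le> p ^ a * t" by (intro mult_le_mono2) simp
    then show ?thesis using s t q(2) by simp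
  qed
  have qn: "p ^ a \<le> p ^ n" using q(3) p1 by (intro power_increasing) auto
  let ?v = "\<lambda>i. multiplicity p (fact i :: nat)"
  have "?v (m + k) = ?v V + ?v (r + k)"
    using multiplicity_fact_add[OF p V(1) rk] V(2) by (simp add: add.assoc)
  also have "?v (r + k) = ?v r + ?v k" using multiplicity_fact_add[OF p r q(2)] .
  finally have 1: "?v (m + k) = ?v V + ?v r + ?v k" by simp
  have 2: "?v (V + k) = ?v V + ?v k"
    using multiplicity_fact_add[OF p V(1), of k] q(2) qn by simp
  have "fact (k + V) * fact r * ((m + k) choose (k + V)) = (fact (m + k) :: nat)"
    using binomial_fact_lemma[of "k + V" "m + k"] V(2) by simp
  then have "?v (m + k) = ?v (k + V) + ?v r + multiplicity p ((m + k) choose (k + V))"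
    using p V(2) by (metis (no_types, lifting) prime_elem_multiplicity_mult_distrib fact_nonzero
      mult_eq_0_iff prime_imp_prime_elem)
  then have "multiplicity p ((m + k) choose (k + V)) = 0"
    using 1 2 by (simp add: add.commute)
  moreover have "(m + k) choose (k + V) \<noteq> 0" using V(2) by simp
  ultimately show ?thesis
    using p1 by (simp add: multiplicity_eq_zero_iff V_def r_def)
qed

section \<open>Factor degrees of generalized Laguerre polynomials\<close>

text \<open>
  This is \<open>(- 1)\<^sup>m m!\<close> times the generalized Laguerre polynomial of degree \<open>m\<close> and
  parameter \<open>k\<close>, written with the summation index of the star product.
\<close>

definition laguerre :: "nat \<Rightarrow> nat \<Rightarrow> int poly" where
  "laguerre m k = (\<Sum>i\<le>m. monom ((- 1) ^ i * fact i * of_nat (m choose i) * of_nat ((m + k) choose i)) (m - i))"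

lemma coeff_laguerre:
  "coeff (laguerre m k) j =
    (if j \<le> m then (- 1) ^ (m - j) * fact (m - j) * of_nat (m choose (m - j)) * of_nat ((m + k) choose (m - j)) else 0)"
proof -
  have "coeff (laguerre m k) j = (\<Sum>i\<le>m. if i = m - j \<and> j \<le> m
      then (- 1) ^ i * fact i * of_nat (m choose i) * of_nat ((m + k) choose i) else 0)"
    unfolding laguerre_def coeff_sum by (intro sum.cong) auto
  also have "\<dots> = (if j \<le> m then (- 1) ^ (m - j) * fact (m - j) * of_nat (m choose (m - j)) * of_nat ((m + k) choose (m - j)) else 0)"
    by (cases "j \<le> m") auto
  finally show ?thesis .
qed

lemma degree_laguerre: "degree (laguerre m k) = m"
  by (rule antisym[OF degree_le le_degree]) (auto simp: coeff_laguerre)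

lemma multiplicity_int: "multiplicity (int p) (int n) = multiplicity p n"
proof -
  have "{i. int p ^ i dvd int n} = {i. p ^ i dvd n}"
    by (metis of_nat_power int_dvd_int_iff)
  then show ?thesis by (simp add: multiplicity_def)
qed

text \<open>
  The coefficient at \<open>j\<close> is, up to sign, \<open>m! / j!\<close> times a binomial coefficient. The weight is the height
  with its sign reversed and the part independent of \<open>j\<close> dropped, so it is the reversed height
  for the exponential series minus a penalty for the binomial coefficient.
\<close>

definition weight :: "nat \<Rightarrow> real \<Rightarrow> nat \<Rightarrow> nat \<Rightarrow> nat \<Rightarrow> real" where
  "weight p \<sigma> m k j = real (multiplicity p (fact j :: nat)) - \<sigma> * real j
     - real (multiplicity p ((m + k) choose (k + j)))"

lemma height_laguerre:
  assumes p: "prime p" and C: "C \<noteq> 0" and j: "j \<le> m"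
  shows "height (int p) \<sigma> (smult C (laguerre m k)) j =
    real (multiplicity (int p) C) + real (multiplicity p (fact m :: nat)) - weight p \<sigma> m k j"
proof -
  let ?B = "fact (m - j) * (m choose (m - j)) * ((m + k) choose (m - j)) :: nat"
  let ?v = "multiplicity p"
  have pe: "prime_elem (int p)" "prime_elem p" using p by auto
  have "(m + k) choose (m - j) = (m + k) choose (k + j)"
    using j binomial_symmetric[of "m - j" "m + k"] by (simp add: add.commute)
  then have "fact j * ?B = fact m * ((m + k) choose (k + j))"
    using binomial_fact_lemma[of "m - j" m] j by (simp add: algebra_simps)
  moreover have "?v (fact j * ?B) = ?v (fact j) + ?v ?B"
    using pe j by (intro prime_elem_multiplicity_mult_distrib) auto
  moreover have "?v (fact m * ((m + k) choose (k + j))) = ?v (fact m) + ?v ((m + k) choose (k + j))"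
    using pe j by (intro prime_elem_multiplicity_mult_distrib) auto
  ultimately have B: "?v (fact j) + ?v ?B = ?v (fact m) + ?v ((m + k) choose (k + j))"
    by simp
  have "coeff (smult C (laguerre m k)) j = C * ((- 1) ^ (m - j) * int ?B)"
    using j by (simp add: coeff_laguerre mult.assoc)
  moreover have "multiplicity (int p) (C * ((- 1) ^ (m - j) * int ?B))
      = multiplicity (int p) C + multiplicity (int p) ((- 1) ^ (m - j) * int ?B)"
    using pe C j by (intro prime_elem_multiplicity_mult_distrib) auto
  moreover have "multiplicity (int p) ((- 1) ^ (m - j) * int ?B) = ?v ?B"
    by (subst multiplicity_times_unit_right) (auto simp: multiplicity_int simp del: of_nat_mult)
  ultimately have "multiplicity (int p) (coeff (smult C (laguerre m k)) j)
      = multiplicity (int p) C + ?v ?B" by (simp only:)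
  then have "height (int p) \<sigma> (smult C (laguerre m k)) j
      = real (multiplicity (int p) C) + real (?v ?B) + \<sigma> * real j"
    by (simp add: height_def)
  moreover have "real (?v (fact j)) + real (?v ?B)
      = real (?v (fact m)) + real (?v ((m + k) choose (k + j)))"
    using B by (simp flip: of_nat_add)
  ultimately show ?thesis by (simp add: weight_def)
qed

lemma face_laguerre:
  assumes "prime p" "C \<noteq> 0"
  shows "face (int p) \<sigma> (smult C (laguerre m k))
    = {i. i \<le> m \<and> (\<forall>j\<le>m. weight p \<sigma> m k j \<le> weight p \<sigma> m k i)}"
proof -
  have nz: "coeff (smult C (laguerre m k)) i \<noteq> 0 \<longleftrightarrow> i \<le> m" for i
    using assms by (auto simp: coeff_laguerre)
  show ?thesis
    unfolding face_def nz using height_laguerre[OF assms] by auto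
qed

lemma coeff_0_laguerre: "coeff (laguerre m k) 0 \<noteq> 0"
  by (simp add: coeff_laguerre)

text \<open>
  Heights are at least those of the truncated exponential of degree \<open>m\<close>, because binomial
  coefficients are integers, and at its vertices they are equal by \<open>binomial_not_dvd\<close>. So the two
  polygons agree. The scalar \<open>C\<close> comes from clearing denominators in a rational factorization.
\<close>

lemma prime_power_dvd_factor_degree:
  assumes p: "prime p" and q: "p ^ a dvd m" "k < p ^ a" "0 < a"
    and C: "C \<noteq> 0" and fact: "smult C (laguerre m k) = g * h"
  shows "p ^ a dvd degree g"
proof -
  let ?F = "face (int p)"
  have uniq: "i = j"
    if ne: "\<And>n. a \<le> n \<Longrightarrow> \<sigma> \<noteq> edge_slope p n" and ij: "i \<in> ?F \<sigma> (g * h)" "j \<in> ?F \<sigma> (g * h)" for \<sigma> i j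
  proof -
    obtain n where n: "a \<le> n" and less: "\<And>j. j \<le> m \<Longrightarrow> j \<noteq> m - m mod p ^ n \<Longrightarrow>
       real (multiplicity p (fact j :: nat)) - \<sigma> * real j
       < real (multiplicity p (fact (m - m mod p ^ n) :: nat)) - \<sigma> * real (m - m mod p ^ n)"
      using truncated_exponential_vertex[OF p q(1) ne] by blast
    define V where "V = m - m mod p ^ n"
    have unit: "multiplicity p ((m + k) choose (k + V)) = 0"
      using binomial_not_dvd[OF p q(1,2) n] by (simp add: V_def not_dvd_imp_multiplicity_0)
    have "i = V" if "i \<in> ?F \<sigma> (g * h)" for i
    proof (rule ccontr)
      assume "i \<noteq> V"
      moreover have "i \<le> m" "weight p \<sigma> m k V \<le> weight p \<sigma> m k i"
        using that by (auto simp: fact[symmetric] face_laguerre[OF p C] V_def)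
      ultimately show False
        using less[of i] unit by (simp add: weight_def V_def)
    qed
    then show "i = j" using ij by blast
  qed
  have "\<exists>t\<le>0. int (p ^ a) dvd int (degree g) - int t"
  proof (rule degree_factor_from_slopes[where p = "int p" and \<rho> = 0])
    show "prime (int p)" using p by simp
    show "coeff (g * h) 0 \<noteq> 0" using C coeff_0_laguerre by (simp flip: fact)
    show "int j - int i \<le> int 0" if "i \<in> ?F 0 (g * h)" "j \<in> ?F 0 (g * h)" for i j
    proof -
      have "0 \<noteq> edge_slope p n" if "a \<le> n" for n
        using edge_slope_bounds(1)[OF p, of n] q(3) that by simp
      then have "i = j" using uniq[of 0] that by blast
      then show ?thesis by simp
    qed
    show "int (p ^ a) dvd d" if "i \<in> ?F \<sigma> (g * h)" "j \<in> ?F \<sigma> (g * h)" "i \<noteq> j"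
      "\<sigma> * of_int d = of_int z" for \<sigma> i j d z
    proof -
      have "\<exists>n\<ge>a. \<sigma> = edge_slope p n" using uniq[of \<sigma> i j] that(1-3) by blast
      then obtain n where "a \<le> n" "\<sigma> = edge_slope p n" by blast
      then show ?thesis
        using edge_slope_denominator[OF p] that(4) by (metis dvd_trans le_imp_power_dvd of_nat_power)
    qed
  qed
  then show ?thesis by (simp flip: int_dvd_int_iff)
qed

lemma not_dvd_SucI:
  fixes p :: nat
  assumes "1 < p" "p dvd n" shows "\<not> p dvd Suc n"
  using dvd_add_right_iff[OF assms(2), of 1] assms(1) by simp

text \<open>
  For degree \<open>m + 1\<close> with \<open>m\<close> divisible by \<open>p\<^sup>a\<close>, the polygon is that of
  \<open>p\<^sup>e + x\<close> times the truncated exponential \<open>E\<close> of degree \<open>m\<close>, where \<open>p\<^sup>e\<close> is the part of \<open>k + 1\<close>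
  at \<open>p\<close>. A vertex \<open>V\<close> of \<open>E\<close> appears once in place, with penalty \<open>e\<close>, and once shifted to
  \<open>V + 1\<close>, without penalty. The first wins if \<open>\<sigma> > e\<close>, the second if \<open>\<sigma> < e\<close>, and \<open>\<sigma> = e\<close> gives
  the edge of length 1 between them. The integer \<open>e\<close> is not an edge slope of \<open>E\<close>, as these lie
  strictly between 0 and 1.
\<close>

lemma prime_power_dvd_factor_degree_or_pred:
  assumes p: "prime p" and q: "p ^ a dvd m" "Suc k < p ^ a"
    and C: "C \<noteq> 0" and fact: "smult C (laguerre (Suc m) k) = g * h"
  shows "\<exists>t\<le>1. int (p ^ a) dvd int (degree g) - int t"
proof -
  let ?F = "face (int p)" and ?v = "multiplicity p"
  define b where "b j = (Suc m + k) choose (k + j)" for j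
  define e where "e = ?v (Suc k)"
  have p1: "1 < p" using p by (rule prime_gt_1_nat)
  have a0: "0 < a" using q(2) by (cases a) auto
  have ea: "e < a"
  proof -
    have "p ^ e \<le> Suc k" unfolding e_def by (intro dvd_imp_le multiplicity_dvd) simp
    then have "p ^ e < p ^ a" using q(2) by simp
    then show ?thesis using p1 by simp
  qed
  have pm: "p dvd m" using q(1) a0 by (meson dvd_power dvd_trans)
  have rec: "b j * (Suc m - j) = b (Suc j) * Suc (k + j)" if "j \<le> m" for j
    using binomial_absorb_comp[of "Suc m + k" "k + j"] binomial_absorption[of "k + j" "Suc m + k"]
    by (simp add: b_def mult.commute del: binomial_Suc_Suc)
  have bne: "b j \<noteq> 0" if "j \<le> Suc m" for j using that by (simp add: b_def)
  \<comment> \<open>This says that no point lies below the polygon of the product: a multiple of \<open>p\<^sup>e\<close>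
      carries the penalty \<open>e\<close>, and for other \<open>j\<close> the penalty is at least the gain of \<open>j!\<close> over \<open>(j - 1)!\<close>.\<close>
  have bdvd: "p ^ t dvd b j" if t: "p ^ t dvd j" "t \<le> e" and j: "j \<le> Suc m" for t j
  proof (cases "t = 0")
    case False
    then have pj: "p dvd j" using t(1) by (meson dvd_power dvd_trans gr0I)
    have "\<not> p dvd Suc m" by (rule not_dvd_SucI[OF p1 pm])
    then have "j \<noteq> Suc m" using pj by auto
    then have jm: "j \<le> m" using j by simp
    have "\<not> p dvd Suc m - j"
      using dvd_diffD[of p "Suc m" j] pj \<open>\<not> p dvd Suc m\<close> j by blast
    then have "coprime (p ^ t) (Suc m - j)"
      using p by (simp add: prime_imp_coprime)
    moreover have "p ^ t dvd Suc (k + j)"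
    proof -
      have "p ^ t dvd Suc k" using t(2) unfolding e_def by (rule multiplicity_dvd')
      then have "p ^ t dvd Suc k + j" using t(1) by (rule dvd_add)
      then show ?thesis by simp
    qed
    then have "p ^ t dvd b j * (Suc m - j)" unfolding rec[OF jm] by (rule dvd_mult)
    ultimately show ?thesis by (simp add: coprime_dvd_mult_left_iff)
  qed simp
  have uniq: "\<exists>V. \<forall>i \<in> ?F \<sigma> (g * h). i \<in> {V, Suc V} \<and> (\<sigma> < real e \<longrightarrow> i = Suc V) \<and> (real e < \<sigma> \<longrightarrow> i = V)"
    if ne: "\<And>n. a \<le> n \<Longrightarrow> \<sigma> \<noteq> edge_slope p n" for \<sigma>
  proof -
    define \<phi> where "\<phi> j = real (?v (fact j :: nat)) - \<sigma> * real j" for j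
    have weight: "weight p \<sigma> (Suc m) k j = \<phi> j - real (?v (b j))" for j
      by (simp add: weight_def \<phi>_def b_def)
    obtain n where n: "a \<le> n" and less: "\<And>j. j \<le> m \<Longrightarrow> j \<noteq> m - m mod p ^ n \<Longrightarrow>
       \<phi> j < \<phi> (m - m mod p ^ n)"
      unfolding \<phi>_def using truncated_exponential_vertex[OF p q(1) ne] by blast
    define V where "V = m - m mod p ^ n"
    have less: "\<phi> j < \<phi> V" if "j \<le> m" "j \<noteq> V" for j using less that by (simp add: V_def)
    have Vm: "V \<le> m" by (simp add: V_def)
    have pd: "p ^ a dvd p ^ n" using n by (rule le_imp_power_dvd)
    have pV: "p ^ a dvd V"
      using dvd_trans[OF pd, of V] by (simp add: V_def dvd_minus_mod)
    have pV1: "p dvd V" using pV a0 by (meson dvd_power dvd_trans)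
    have unit: "?v (b (Suc V)) = 0"
      using binomial_not_dvd[OF p q n] by (simp add: V_def b_def not_dvd_imp_multiplicity_0)
    have bV: "?v (b V) = e"
    proof -
      have "\<not> p dvd Suc m - V"
        using not_dvd_SucI[OF p1, of "m - V"] pV1 pm Vm by (simp add: Suc_diff_le)
      then have "?v (Suc m - V) = 0" by (rule not_dvd_imp_multiplicity_0)
      moreover have "?v (Suc (k + V)) = e"
      proof -
        have "p ^ i dvd Suc (k + V) \<longleftrightarrow> p ^ i dvd Suc k" if "i \<le> a" for i
        proof -
          have "p ^ i dvd V" using pV that by (meson dvd_trans le_imp_power_dvd)
          then show ?thesis using dvd_add_left_iff[of "p ^ i" V "Suc k"] by simp
        qed
        then have "p ^ e dvd Suc (k + V)" "\<not> p ^ Suc e dvd Suc (k + V)"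
          using ea p1 by (auto simp: e_def multiplicity_dvd power_dvd_iff_le_multiplicity simp del: power_Suc)
        then show ?thesis by (rule multiplicity_eqI)
      qed
      moreover have "?v (b V * (Suc m - V)) = ?v (b V) + ?v (Suc m - V)"
        "?v (b (Suc V) * Suc (k + V)) = ?v (b (Suc V)) + ?v (Suc (k + V))"
        using p Vm bne by (auto intro!: prime_elem_multiplicity_mult_distrib simp del: mult_Suc_right)
      ultimately show ?thesis using rec[OF Vm] unit by simp
    qed
    have wV: "weight p \<sigma> (Suc m) k V = \<phi> V - real e" by (simp add: weight bV)
    have wSV: "weight p \<sigma> (Suc m) k (Suc V) = \<phi> V - \<sigma>"
    proof -
      have "\<not> p dvd Suc V" by (rule not_dvd_SucI[OF p1 pV1])
      then have "?v (Suc V) = 0" by (rule not_dvd_imp_multiplicity_0)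
      then have "?v (fact (Suc V) :: nat) = ?v (fact V :: nat)"
        using p unfolding fact_Suc of_nat_id by (subst prime_elem_multiplicity_mult_distrib) auto
      then show ?thesis by (simp add: weight unit \<phi>_def algebra_simps del: fact_Suc)
    qed
    have "i \<in> {V, Suc V} \<and> (\<sigma> < real e \<longrightarrow> i = Suc V) \<and> (real e < \<sigma> \<longrightarrow> i = V)"
      if "i \<in> ?F \<sigma> (g * h)" for i
    proof -
      have i: "i \<le> Suc m" "weight p \<sigma> (Suc m) k V \<le> weight p \<sigma> (Suc m) k i"
        "weight p \<sigma> (Suc m) k (Suc V) \<le> weight p \<sigma> (Suc m) k i"
        using that Vm by (auto simp: fact[symmetric] face_laguerre[OF p C])
      have "i \<in> {V, Suc V}"
      proof (rule ccontr)
        assume ni: "i \<notin> {V, Suc V}"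
        show False
        \<comment> \<open>A point \<open>i\<close> divisible by \<open>p\<^sup>e\<^sup>+\<^sup>1\<close> is compared with \<open>V\<close>, any other one with \<open>V + 1\<close>. The power
            \<open>e + 1\<close> instead of \<open>e\<close> excludes \<open>i = m + 1\<close> from the first case even if \<open>e = 0\<close>.\<close>
        proof (cases "p ^ Suc e dvd i")
          case True
          then have "p dvd i" "p ^ e dvd i" by (auto dest: dvd_mult_left dvd_mult_right)
          then have "p ^ e dvd b i" using i(1) by (intro bdvd) auto
          then have "e \<le> ?v (b i)"
            using bne[OF i(1)] p1 by (simp add: power_dvd_iff_le_multiplicity)
          moreover have "i \<noteq> Suc m"
            using not_dvd_SucI[OF p1 pm] \<open>p dvd i\<close> by auto
          then have "\<phi> i < \<phi> V" using i(1) ni by (intro less) auto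
          ultimately show False using i(2)[unfolded wV] by (simp add: weight)
        next
          case False
          then obtain i' where i': "i = Suc i'" by (cases i) auto
          have "?v i \<le> e"
            using False i' p1 by (simp add: power_dvd_iff_le_multiplicity not_le del: power_Suc)
          then have "p ^ ?v i dvd b i" using i(1) by (intro bdvd multiplicity_dvd)
          then have "?v i \<le> ?v (b i)"
            using bne[OF i(1)] p1 by (simp add: power_dvd_iff_le_multiplicity)
          moreover have "?v (fact i :: nat) = ?v i + ?v (fact i' :: nat)"
            using p unfolding i' fact_Suc of_nat_id by (subst prime_elem_multiplicity_mult_distrib) auto
          moreover have "\<phi> i' < \<phi> V" using i(1) ni i' by (intro less) auto
          ultimately show False
            using i(3)[unfolded wSV] by (simp add: weight \<phi>_def i' algebra_simps del: fact_Suc)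
        qed
      qed
      then show ?thesis using i(2,3) by (auto simp: wV wSV)
    qed
    then show ?thesis by blast
  qed
  have ne_e: "real e \<noteq> edge_slope p n" if "a \<le> n" for n
    using edge_slope_bounds[OF p, of n] a0 that by (cases e) auto
  show ?thesis
  proof (rule degree_factor_from_slopes[where p = "int p" and \<rho> = "real e"])
    show "prime (int p)" using p by simp
    show "coeff (g * h) 0 \<noteq> 0" using C coeff_0_laguerre by (simp flip: fact)
    show "int j - int i \<le> int 1" if "i \<in> ?F (real e) (g * h)" "j \<in> ?F (real e) (g * h)" for i j
    proof -
      have "\<exists>V. \<forall>i \<in> ?F (real e) (g * h). i \<in> {V, Suc V}" using uniq[of "real e"] ne_e by blast
      then obtain V where "\<forall>i \<in> ?F (real e) (g * h). i \<in> {V, Suc V}" by blast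
      then have "i \<in> {V, Suc V}" "j \<in> {V, Suc V}" using that by blast+
      then show ?thesis by auto
    qed
    show "int (p ^ a) dvd d" if "\<sigma> \<noteq> real e" "i \<in> ?F \<sigma> (g * h)" "j \<in> ?F \<sigma> (g * h)" "i \<noteq> j"
      "\<sigma> * of_int d = of_int z" for \<sigma> i j d z
    proof -
      have "\<exists>n\<ge>a. \<sigma> = edge_slope p n"
      proof (rule ccontr)
        assume "\<not> ?thesis"
        then have "\<exists>V. \<forall>i \<in> ?F \<sigma> (g * h). (\<sigma> < real e \<longrightarrow> i = Suc V) \<and> (real e < \<sigma> \<longrightarrow> i = V)"
          using uniq[of \<sigma>] by blast
        then obtain V where V: "\<And>i. i \<in> ?F \<sigma> (g * h) \<Longrightarrow> \<sigma> < real e \<Longrightarrow> i = Suc V"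
          "\<And>i. i \<in> ?F \<sigma> (g * h) \<Longrightarrow> real e < \<sigma> \<Longrightarrow> i = V" by blast
        have "\<sigma> < real e \<or> real e < \<sigma>" using that(1) by linarith
        then have "i = j"
          by (rule disjE) (use V(1)[OF that(2)] V(1)[OF that(3)] V(2)[OF that(2)] V(2)[OF that(3)] in simp_all)
        then show False using that(4) by simp
      qed
      then obtain n where "a \<le> n" "\<sigma> = edge_slope p n" by blast
      then show ?thesis
        using edge_slope_denominator[OF p] that(5) by (metis dvd_trans le_imp_power_dvd of_nat_power)
    qed
  qed
qed

lemma dvd_if_prime_power_dvd:
  fixes n x :: nat
  assumes "n \<noteq> 0" and "\<And>p. prime p \<Longrightarrow> p ^ multiplicity p n dvd x"
  shows "n dvd x"
proof (cases "x = 0")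
  case False
  show ?thesis
  proof (rule multiplicity_le_imp_dvd[OF assms(1)])
    fix p :: nat assume p: "prime p"
    then have "\<not> is_unit p" by auto
    with assms(2)[OF p] False show "multiplicity p n \<le> multiplicity p x"
      by (simp add: power_dvd_iff_le_multiplicity)
  qed
qed simp

text \<open>
  Prime powers that are too small for the two congruences divide \<open>k!\<close> or \<open>(k + 1)!\<close>, which is why
  these factors appear. The rest is the arithmetic of \<open>K l = M u\<close> with \<open>M \<equiv> 1\<close> modulo \<open>m\<close>.
\<close>

lemma laguerre_no_proper_factor:
  assumes large: "fact (Suc k) * fact k ^ 2 < m"
    and C: "C \<noteq> 0" and eq: "smult C (laguerre (Suc m) k) = g * h"
  shows "degree g = 0 \<or> degree h = 0"
proof (rule ccontr)
  assume nontrivial: "\<not> ?thesis"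
  define l where "l = degree g"
  define M where "M = Suc m"
  have "laguerre (Suc m) k \<noteq> 0" using coeff_0_laguerre[of "Suc m" k] by auto
  then have "g * h \<noteq> 0" using C by (simp flip: eq)
  then have "degree g + degree h = degree (g * h)" by (auto simp: degree_mult_eq)
  also have "\<dots> = M" using C by (simp add: degree_laguerre M_def flip: eq)
  finally have l: "0 < l" "l < M" using nontrivial by (auto simp: l_def)
  define K where "K = (fact k :: nat)"
  have "M dvd K * l"
  proof (rule dvd_if_prime_power_dvd)
    fix p :: nat assume p: "prime p"
    let ?q = "p ^ multiplicity p M"
    show "?q dvd K * l"
    proof (cases "?q \<le> k")
      case True
      then show ?thesis using p by (simp add: K_def dvd_fact prime_gt_0_nat Suc_le_eq)
    next
      case False
      then have "?q dvd l"
        using prime_power_dvd_factor_degree[OF p multiplicity_dvd _ _ C eq]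
        by (cases "multiplicity p M = 0") (auto simp: l_def M_def)
      then show ?thesis by simp
    qed
  qed (simp add: M_def)
  then obtain u where u: "K * l = M * u" by blast
  have "K \<noteq> 0" by (simp add: K_def)
  then have u0: "0 < u" using u l by (cases "u = 0") auto
  have uK: "u < K"
  proof -
    have "K * l < K * M" using l \<open>K \<noteq> 0\<close> by simp
    then have "M * u < M * K" by (simp add: u mult.commute)
    then show ?thesis by simp
  qed
  have "m dvd fact (Suc k) * (u * (K - u))"
  proof (rule dvd_if_prime_power_dvd)
    fix p :: nat assume p: "prime p"
    let ?q = "p ^ multiplicity p m"
    show "?q dvd fact (Suc k) * (u * (K - u))"
    proof (cases "?q \<le> Suc k")
      case True
      then have "?q dvd fact (Suc k)" using p by (intro dvd_fact) (auto simp: prime_gt_0_nat Suc_le_eq)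
      then show ?thesis by (rule dvd_mult2)
    next
      case False
      then obtain t where t: "t \<le> 1" "int ?q dvd int l - int t"
        using prime_power_dvd_factor_degree_or_pred[OF p multiplicity_dvd _ C eq] by (auto simp: l_def)
      have "int K * (int l - int t) = int (K * l) - int K * int t" by (simp add: algebra_simps)
      also have "\<dots> = int m * int u + (int u - int K * int t)"
        unfolding u by (simp add: M_def algebra_simps)
      finally have "int u - int K * int t = int K * (int l - int t) - int m * int u" by simp
      moreover have "int ?q dvd int m * int u"
        by (intro dvd_mult2) (simp only: int_dvd_int_iff multiplicity_dvd)
      moreover have "int ?q dvd int K * (int l - int t)" using t(2) by simp
      ultimately have d: "int ?q dvd int u - int K * int t" by (metis dvd_diff)
      have "?q dvd u \<or> ?q dvd K - u"
      proof (cases "t = 0")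
        case True
        then have "int ?q dvd int u" using d by simp
        then have "?q dvd u" by (simp only: int_dvd_int_iff)
        then show ?thesis ..
      next
        case False
        then have "t = 1" using t(1) by simp
        then have "int ?q dvd int (K - u)" using d uK by (simp add: of_nat_diff dvd_diff_commute)
        then have "?q dvd K - u" by (simp only: int_dvd_int_iff)
        then show ?thesis ..
      qed
      then show ?thesis by auto
    qed
  qed (use large in simp)
  moreover have "0 < fact (Suc k) * (u * (K - u))" using u0 uK by simp
  ultimately have "m \<le> fact (Suc k) * (u * (K - u))" by (rule dvd_imp_le)
  also have "\<dots> \<le> fact (Suc k) * (K * K)"
    using uK by (intro mult_le_mono) auto
  finally show False using large by (simp add: K_def power2_eq_square)
qed

lemma rat_poly_common_denominator:
  fixes f :: "rat poly"
  shows "\<exists>c F. c \<noteq> 0 \<and> smult (of_int c) f = map_poly of_int F"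
proof (induction f)
  case 0
  show ?case by (intro exI[of _ 1] exI[of _ 0]) simp
next
  case (pCons a f)
  then obtain c F where cF: "c \<noteq> 0" "smult (of_int c) f = map_poly of_int F" by blast
  obtain x y where xy: "quotient_of a = (x, y)" by force
  then have y: "y > 0" "a = of_int x / of_int y"
    by (auto intro: quotient_of_denom_pos quotient_of_div)
  have "smult (of_int (c * y)) (pCons a f) = pCons (of_int (c * x)) (smult (of_int y) (smult (of_int c) f))"
    using y by (simp add: mult.commute)
  also have "\<dots> = map_poly of_int (pCons (c * x) (smult y F))"
    unfolding cF(2) by (intro poly_eqI) (simp add: coeff_map_poly coeff_pCons split: nat.split)
  finally show ?case using cF(1) y(1) by (intro exI[of _ "c * y"]) auto
qed

lemma map_poly_mult_hom:
  fixes f :: "'a::comm_ring_1 \<Rightarrow> 'b::comm_ring_1"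
  assumes add: "\<And>x y. f (x + y) = f x + f y" and mult: "\<And>x y. f (x * y) = f x * f y"
  shows "map_poly f (p * q) = map_poly f p * map_poly f q"
proof -
  have f0: "f 0 = 0" using add[of 0 0] by simp
  have "f (sum s A) = (\<Sum>x\<in>A. f (s x))" for s :: "nat \<Rightarrow> 'a" and A
    by (induction A rule: infinite_finite_induct) (auto simp: f0 add)
  then show ?thesis by (intro poly_eqI) (simp add: coeff_map_poly f0 coeff_mult mult)
qed

lemma laguerre_rat_no_proper_factor:
  assumes large: "fact (Suc k) * fact k ^ 2 < m"
    and eq: "map_poly of_int (laguerre (Suc m) k) = g * (h :: rat poly)"
  shows "degree g = 0 \<or> degree h = 0"
proof -
  obtain c G where G: "c \<noteq> 0" "smult (of_int c) g = map_poly of_int G"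
    using rat_poly_common_denominator by blast
  obtain d H where H: "d \<noteq> 0" "smult (of_int d) h = map_poly of_int H"
    using rat_poly_common_denominator by blast
  let ?r = "map_poly of_int :: int poly \<Rightarrow> rat poly"
  have "?r (smult (c * d) (laguerre (Suc m) k)) = smult (of_int (c * d)) (g * h)"
    by (subst eq[symmetric]) (intro poly_eqI, simp add: coeff_map_poly)
  also have "\<dots> = ?r (G * H)"
    by (simp add: map_poly_mult_hom mult.commute flip: G(2) H(2))
  finally have "smult (c * d) (laguerre (Suc m) k) = G * H"
    by (simp add: poly_eq_iff coeff_map_poly flip: of_int_mult)
  then have "degree G = 0 \<or> degree H = 0"
    using G(1) H(1) by (intro laguerre_no_proper_factor[OF large]) auto
  moreover have "degree (?r P) = degree P" for P
    by (intro degree_map_poly) auto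
  ultimately show ?thesis
    using G(1) H(1) arg_cong[OF G(2), of degree] arg_cong[OF H(2), of degree] by simp
qed

section \<open>From one variable to two\<close>

text \<open>
  The polynomial \<open>F(\<xi>z)\<close>.
\<close>

definition diagonal :: "'a::comm_semiring_1 poly \<Rightarrow> 'a poly poly" where
  "diagonal F = (\<Sum>i\<le>degree F. monom (monom (coeff F i) i) i)"

lemma coeff_diagonal: "coeff (diagonal F) i = monom (coeff F i) i"
proof -
  have "coeff (diagonal F) i = (\<Sum>j\<le>degree F. if j = i then monom (coeff F i) i else 0)"
    unfolding diagonal_def coeff_sum by (intro sum.cong) auto
  also have "\<dots> = monom (coeff F i) i" by (simp add: coeff_eq_0)
  finally show ?thesis .
qed

lemma diagonal_sum: "diagonal (\<Sum>i\<in>A. f i) = (\<Sum>i\<in>A. diagonal (f i))"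
  by (intro poly_eqI) (simp add: coeff_diagonal coeff_sum)

lemma diagonal_monom: "diagonal (monom c n) = monom (monom c n) n"
  by (intro poly_eqI) (simp add: coeff_diagonal)

lemma degree_diagonal: "degree (diagonal F) = degree F"
proof (rule antisym)
  show "degree (diagonal F) \<le> degree F"
    by (rule degree_le) (simp add: coeff_diagonal coeff_eq_0)
  show "degree F \<le> degree (diagonal F)"
    by (cases "F = 0") (auto simp: coeff_diagonal intro!: le_degree)
qed

text \<open>
  Setting \<open>\<xi> = 1\<close> maps \<open>F(\<xi>z)\<close> to \<open>F(z)\<close>, so one of the factors becomes constant. The specialization
  preserves degrees in \<open>z\<close>, because the leading coefficients of the factors divide that of \<open>F(\<xi>z)\<close>, which
  does not vanish at 1. So this factor is a polynomial in \<open>\<xi>\<close> alone. It divides the constant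
  coefficient of \<open>F\<close>, a nonzero scalar, and is a unit.
\<close>

lemma irreducible_diagonal:
  fixes F :: "'a::field poly"
  assumes deg: "0 < degree F" and F0: "coeff F 0 \<noteq> 0"
    and prim: "\<And>g h. F = g * h \<Longrightarrow> degree g = 0 \<or> degree h = 0"
  shows "irreducible (diagonal F)"
proof (rule irreducibleI)
  define spec :: "'a poly poly \<Rightarrow> 'a poly" where "spec = map_poly (\<lambda>c. poly c 1)"
  have spec_mult: "spec (P * Q) = spec P * spec Q" for P Q
    unfolding spec_def by (rule map_poly_mult_hom) simp_all
  have spec_F: "spec (diagonal F) = F"
    by (intro poly_eqI) (simp add: spec_def coeff_map_poly coeff_diagonal poly_monom)
  show "diagonal F \<noteq> 0" using deg degree_diagonal[of F] by auto
  show "\<not> is_unit (diagonal F)" using deg degree_diagonal[of F] by (auto simp: is_unit_poly_iff)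
  fix G H assume GH: "diagonal F = G * H"
  have unit: "is_unit G" if GH: "diagonal F = G * H" and d: "degree (spec G) = 0" for G H
  proof -
    have "lead_coeff G * lead_coeff H = lead_coeff (diagonal F)" by (simp add: GH lead_coeff_mult)
    then have "poly (lead_coeff G) 1 * poly (lead_coeff H) 1 = lead_coeff F"
      by (simp add: degree_diagonal coeff_diagonal poly_monom flip: poly_mult)
    then have "coeff (spec G) (degree G) \<noteq> 0"
      using deg by (auto simp: spec_def coeff_map_poly)
    then have "degree G = 0" using d le_degree by force
    then obtain c where c: "G = [:c:]" by (metis degree_eq_zeroE)
    have "coeff (diagonal F) 0 = c * coeff H 0" by (simp add: GH c)
    then have "c dvd [:coeff F 0:]" by (simp add: coeff_diagonal monom_0)
    then have "is_unit c" using F0 by (meson dvd_trans is_unit_const_poly_iff dvd_field_iff)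
    then show ?thesis by (simp add: c is_unit_const_poly_iff)
  qed
  have "degree (spec G) = 0 \<or> degree (spec H) = 0"
    using prim[of "spec G" "spec H"] spec_F by (simp add: GH spec_mult)
  then show "is_unit G \<or> is_unit H"
    using unit[OF GH] unit[of H G] GH by (auto simp: mult.commute)
qed

lemma map_poly_of_int_laguerre:
  "map_poly of_int (laguerre m k) =
    (\<Sum>i\<le>m. monom ((- 1) ^ i * fact i * of_nat (m choose i) * of_nat ((m + k) choose i)) (m - i))"
  by (intro poly_eqI)
     (auto simp: coeff_map_poly laguerre_def coeff_sum intro!: sum.cong)

lemma xivar_zvar_power:
  fixes c :: "'a::comm_semiring_1"
  shows "smult [:c:] (xivar ^ n * zvar ^ n) = monom (monom c n) n"
proof -
  have "zvar ^ n = (monom 1 n :: 'a poly poly)"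
    by (induction n) (simp_all add: zvar_def monom_0 monom_Suc one_pCons smult_monom)
  moreover have "xivar ^ n = [:monom 1 n :: 'a poly:]"
    by (induction n) (simp_all add: xivar_def monom_0 monom_Suc one_pCons)
  ultimately show ?thesis by (simp add: smult_monom)
qed

lemma diagonal_laguerre:
  "diagonal (map_poly of_int (laguerre m k)) =
    (\<Sum>i\<le>m. smult [:(- 1) ^ i * fact i * of_nat (m choose i) * of_nat ((m + k) choose i):]
       (xivar ^ (m - i) * zvar ^ (m - i)))"
  by (simp only: map_poly_of_int_laguerre diagonal_sum diagonal_monom xivar_zvar_power)

lemma star_div_zvar_power:
  "(xivar ^ m \<star> zvar ^ (m + k)) div zvar ^ k = diagonal (map_poly of_int (laguerre m k))"
proof -
  have "xivar ^ m \<star> zvar ^ (m + k) = zvar ^ k * diagonal (map_poly of_int (laguerre m k))"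
  proof -
    have "zvar ^ (m + k - i) = (zvar ^ k * zvar ^ (m - i) :: cpoly)" if "i \<le> m" for i
      using that by (simp add: add.commute flip: power_add)
    then show ?thesis
      unfolding star_xivar_zvar diagonal_laguerre sum_distrib_left
      by (intro sum.cong) (auto simp: mult.left_commute)
  qed
  moreover have "zvar ^ k \<noteq> (0 :: cpoly)" by (simp add: zvar_def)
  ultimately show ?thesis by simp
qed

lemma star_div_xivar_power:
  "(xivar ^ (m + k) \<star> zvar ^ m) div xivar ^ k = diagonal (map_poly of_int (laguerre m k))"
proof -
  have "xivar ^ (m + k) \<star> zvar ^ m = xivar ^ k * diagonal (map_poly of_int (laguerre m k))"
  proof -
    have "xivar ^ (m + k - i) = (xivar ^ k * xivar ^ (m - i) :: cpoly)" if "i \<le> m" for i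
      using that by (simp add: add.commute flip: power_add)
    then show ?thesis
      unfolding star_xivar_zvar diagonal_laguerre sum_distrib_left
      by (intro sum.cong) (auto simp: ac_simps)
  qed
  moreover have "xivar ^ k \<noteq> (0 :: cpoly)" by (simp add: xivar_def)
  ultimately show ?thesis by simp
qed

lemma irreducible_over_rat_diagonal_laguerre:
  assumes "fact (Suc k) * fact k ^ 2 < m"
  shows "irreducible_over_rat (diagonal (map_poly of_int (laguerre (Suc m) k)))"
  unfolding irreducible_over_rat_def
proof (intro exI conjI)
  let ?F = "map_poly of_int (laguerre (Suc m) k) :: rat poly"
  show "diagonal (map_poly of_int (laguerre (Suc m) k)) = map_poly (map_poly of_rat) (diagonal ?F)"
    by (intro poly_eqI) (simp add: coeff_map_poly coeff_diagonal map_poly_monom)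
  have "0 < degree ?F" by (subst degree_map_poly) (auto simp: degree_laguerre)
  moreover have "coeff ?F 0 \<noteq> 0"
    using coeff_0_laguerre[of "Suc m" k] by (simp add: coeff_map_poly)
  ultimately show "irreducible (diagonal ?F)"
    using laguerre_rat_no_proper_factor[OF assms] by (rule irreducible_diagonal)
qed

theorem theorem5p10:
  fixes k :: nat
  shows "finite {m :: nat. \<not> irreducible_over_rat ((xivar ^ m \<star> zvar ^ (m + k)) div zvar ^ k)}
       \<and> finite {m :: nat. \<not> irreducible_over_rat ((xivar ^ (m + k) \<star> zvar ^ m) div xivar ^ k)}"
proof -
  define P where "P m = (diagonal (map_poly of_int (laguerre m k)) :: cpoly)" for m
  have "m \<le> Suc (fact (Suc k) * fact k ^ 2)" if "\<not> irreducible_over_rat (P m)" for m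
  proof (rule ccontr)
    assume "\<not> ?thesis"
    then obtain m' where "m = Suc m'" "fact (Suc k) * fact k ^ 2 < m'" by (cases m) auto
    then show False using irreducible_over_rat_diagonal_laguerre that by (simp add: P_def)
  qed
  then have "{m. \<not> irreducible_over_rat (P m)} \<subseteq> {..Suc (fact (Suc k) * fact k ^ 2)}" by auto
  then have "finite {m. \<not> irreducible_over_rat (P m)}" using finite_subset by blast
  then show ?thesis by (simp only: star_div_zvar_power star_div_xivar_power P_def simp_thms)
qed

end
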